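(* Let $z_0\in\mathbb{C}$ and $r>0$ be such that $0\notin D(z_0,r)=\{z\in\mathbb{C}: |z-z_0|<r\}$. Let $S(D(z_0,r))$ be the set of all functions $f\in\mathcal{H}(D(z_0,r))$ with the property that the set $\{T_N(f): N=0,1,2,\dots\}$ is dense in $\mathcal{H}(D(z_0,r))$. Then $S(D(z_0,r))$ is a dense $G_\delta$ set in $\mathcal{H}(D(z_0,r))$.
   Context: For an open set $\Omega\subset\mathbb{C}$, $\mathcal{H}(\Omega)$ denotes the space of all holomorphic functions on $\Omega$ with the topology of uniform convergence on compact subsets of $\Omega$. For $f\in\mathcal{H}(\Omega)$ and $N\in\{0,1,2,\dots\}$, the function $T_N(f)\in\mathcal{H}(\Omega)$ is defined by $$T_N(f)(z)=\sum_{n=0}^N\frac{f^{(n)}(z)}{n!}(-z)^n,\qquad z\in\Omega,$$ i.e. $T_N(f)(z)$ is the value at the point $0$ of the $N$-th partial sum of the Taylor expansion of $f$ with centre $z$. *)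

theory Defs
  imports "HOL-Complex_Analysis.Complex_Analysis"
begin

text \<open>
  Functions on \<open>\<Omega>\<close> are represented by total functions that take the value \<^term>\<open>undefined\<close>
  outside \<open>\<Omega>\<close>, so that two elements of \<open>holo_funs \<Omega>\<close> are equal iff they agree on \<open>\<Omega>\<close>.
  All notions below are meant for open \<open>\<Omega>\<close>.
\<close>

definition holo_funs :: "complex set \<Rightarrow> (complex \<Rightarrow> complex) set" where
  "holo_funs \<Omega> = {f. f holomorphic_on \<Omega>} \<inter> extensional \<Omega>"

text \<open>
  The topology of uniform convergence on compact subsets of \<open>\<Omega>\<close>: the sets
  \<open>{g \<in> holo_funs \<Omega>. \<forall>z\<in>K. dist (g z) (f z) < \<epsilon>}\<close>, for compact \<open>K \<subseteq> \<Omega>\<close> and \<open>\<epsilon> > 0\<close>, form a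
  neighbourhood base at \<open>f\<close>.
\<close>

definition holo_topology :: "complex set \<Rightarrow> (complex \<Rightarrow> complex) topology" where
  "holo_topology \<Omega> = topology (\<lambda>U. U \<subseteq> holo_funs \<Omega> \<and>
     (\<forall>f\<in>U. \<exists>K \<epsilon>. compact K \<and> K \<subseteq> \<Omega> \<and> 0 < \<epsilon> \<and>
        {g \<in> holo_funs \<Omega>. \<forall>z\<in>K. dist (g z) (f z) < \<epsilon>} \<subseteq> U))"

lemma openin_holo_topology:
  "openin (holo_topology \<Omega>) U \<longleftrightarrow> U \<subseteq> holo_funs \<Omega> \<and>
     (\<forall>f\<in>U. \<exists>K \<epsilon>. compact K \<and> K \<subseteq> \<Omega> \<and> 0 < \<epsilon> \<and>
        {g \<in> holo_funs \<Omega>. \<forall>z\<in>K. dist (g z) (f z) < \<epsilon>} \<subseteq> U)"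
proof -
  define nbd where "nbd f U \<longleftrightarrow> (\<exists>K \<epsilon>. compact K \<and> K \<subseteq> \<Omega> \<and> 0 < \<epsilon> \<and>
    {g \<in> holo_funs \<Omega>. \<forall>z\<in>K. dist (g z) (f z) < \<epsilon>} \<subseteq> U)" for f :: "complex \<Rightarrow> complex" and U
  have mono: "nbd f V" if "nbd f U" "U \<subseteq> V" for f U V
    using that unfolding nbd_def by (meson order_trans)
  have int: "nbd f (U \<inter> V)" if "nbd f U" "nbd f V" for f U V
  proof -
    obtain K \<epsilon> where K: "compact K" "K \<subseteq> \<Omega>" "0 < \<epsilon>"
      "{g \<in> holo_funs \<Omega>. \<forall>z\<in>K. dist (g z) (f z) < \<epsilon>} \<subseteq> U"
      using \<open>nbd f U\<close> unfolding nbd_def by blast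
    obtain L \<delta> where L: "compact L" "L \<subseteq> \<Omega>" "0 < \<delta>"
      "{g \<in> holo_funs \<Omega>. \<forall>z\<in>L. dist (g z) (f z) < \<delta>} \<subseteq> V"
      using \<open>nbd f V\<close> unfolding nbd_def by blast
    have "{g \<in> holo_funs \<Omega>. \<forall>z\<in>K \<union> L. dist (g z) (f z) < min \<epsilon> \<delta>} \<subseteq> U \<inter> V"
      using K(4) L(4) by auto
    then show ?thesis
      using K L unfolding nbd_def by (intro exI[of _ "K \<union> L"] exI[of _ "min \<epsilon> \<delta>"]) auto
  qed
  have "istopology (\<lambda>U. U \<subseteq> holo_funs \<Omega> \<and> (\<forall>f\<in>U. nbd f U))"
    unfolding istopology_def
  proof (intro conjI allI impI)
    fix S T :: "(complex \<Rightarrow> complex) set"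
    assume "S \<subseteq> holo_funs \<Omega> \<and> (\<forall>f\<in>S. nbd f S)" "T \<subseteq> holo_funs \<Omega> \<and> (\<forall>f\<in>T. nbd f T)"
    then show "S \<inter> T \<subseteq> holo_funs \<Omega>" "\<forall>f\<in>S \<inter> T. nbd f (S \<inter> T)"
      using int by blast+
  next
    fix \<K> :: "(complex \<Rightarrow> complex) set set"
    assume *: "\<forall>K\<in>\<K>. K \<subseteq> holo_funs \<Omega> \<and> (\<forall>f\<in>K. nbd f K)"
    show "\<Union> \<K> \<subseteq> holo_funs \<Omega>" using * by blast
    show "\<forall>f\<in>\<Union> \<K>. nbd f (\<Union> \<K>)" using * mono by (meson Union_iff Union_upper)
  qed
  then show ?thesis
    unfolding holo_topology_def nbd_def by (simp add: topology_inverse')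
qed

lemma topspace_holo_topology [simp]: "topspace (holo_topology \<Omega>) = holo_funs \<Omega>"
proof
  show "topspace (holo_topology \<Omega>) \<subseteq> holo_funs \<Omega>"
    using openin_holo_topology openin_topspace by blast
  have "openin (holo_topology \<Omega>) (holo_funs \<Omega>)"
    unfolding openin_holo_topology
    by (auto intro!: exI[of _ "{}"] exI[of _ "1::real"])
  then show "holo_funs \<Omega> \<subseteq> topspace (holo_topology \<Omega>)"
    by (rule openin_subset)
qed

lemma openin_holo_nbd:
  assumes "f \<in> holo_funs \<Omega>" "compact K" "K \<subseteq> \<Omega>"
  shows "openin (holo_topology \<Omega>) {g \<in> holo_funs \<Omega>. \<forall>z\<in>K. dist (g z) (f z) < \<epsilon>}"
  unfolding openin_holo_topology
proof (intro conjI ballI)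
  fix h assume h: "h \<in> {g \<in> holo_funs \<Omega>. \<forall>z\<in>K. dist (g z) (f z) < \<epsilon>}"
  show "\<exists>L \<delta>. compact L \<and> L \<subseteq> \<Omega> \<and> 0 < \<delta> \<and> {g \<in> holo_funs \<Omega>. \<forall>z\<in>L. dist (g z) (h z) < \<delta>}
      \<subseteq> {g \<in> holo_funs \<Omega>. \<forall>z\<in>K. dist (g z) (f z) < \<epsilon>}"
  proof (cases "K = {}")
    case True
    then show ?thesis by (auto intro!: exI[of _ "{}"] exI[of _ "1::real"])
  next
    case False
    have "continuous_on K (\<lambda>z. dist (h z) (f z))"
      using h assms unfolding holo_funs_def
      by (auto intro!: continuous_on_dist holomorphic_on_imp_continuous_on intro: holomorphic_on_subset)
    then obtain w where w: "w \<in> K" "\<forall>z\<in>K. dist (h z) (f z) \<le> dist (h w) (f w)"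
      using continuous_attains_sup[OF \<open>compact K\<close> False] by blast
    have "dist (g z) (f z) < \<epsilon>"
      if "z \<in> K" "dist (g z) (h z) < \<epsilon> - dist (h w) (f w)" for g z
      using that w(2) dist_triangle[of "g z" "f z" "h z"] by force
    then show ?thesis
      using assms h w(1) by (intro exI[of _ K] exI[of _ "\<epsilon> - dist (h w) (f w)"]) auto
  qed
qed auto

lemma limitin_holo_topology:
  assumes "\<And>n. F n \<in> holo_funs \<Omega>"
  shows "limitin (holo_topology \<Omega>) F f sequentially \<longleftrightarrow>
    f \<in> holo_funs \<Omega> \<and> (\<forall>K. compact K \<longrightarrow> K \<subseteq> \<Omega> \<longrightarrow> uniform_limit K F f sequentially)"
proof
  assume L: "limitin (holo_topology \<Omega>) F f sequentially"
  then have f: "f \<in> holo_funs \<Omega>" by (simp add: limitin_def)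
  have "\<forall>\<^sub>F n in sequentially. \<forall>z\<in>K. dist (F n z) (f z) < \<epsilon>"
    if "compact K" "K \<subseteq> \<Omega>" "0 < \<epsilon>" for K \<epsilon>
  proof -
    have "\<forall>\<^sub>F n in sequentially. F n \<in> {g \<in> holo_funs \<Omega>. \<forall>z\<in>K. dist (g z) (f z) < \<epsilon>}"
      using L openin_holo_nbd[OF f that(1,2), of \<epsilon>] f that(3) unfolding limitin_def by auto
    then show ?thesis by (rule eventually_mono) auto
  qed
  with f show "f \<in> holo_funs \<Omega> \<and> (\<forall>K. compact K \<longrightarrow> K \<subseteq> \<Omega> \<longrightarrow> uniform_limit K F f sequentially)"
    by (auto simp: uniform_limit_iff)
next
  assume R: "f \<in> holo_funs \<Omega> \<and> (\<forall>K. compact K \<longrightarrow> K \<subseteq> \<Omega> \<longrightarrow> uniform_limit K F f sequentially)"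
  show "limitin (holo_topology \<Omega>) F f sequentially"
    unfolding limitin_def
  proof (intro conjI allI impI)
    show "f \<in> topspace (holo_topology \<Omega>)" using R by simp
    fix U assume "openin (holo_topology \<Omega>) U \<and> f \<in> U"
    then obtain K \<epsilon> where K: "compact K" "K \<subseteq> \<Omega>" "0 < \<epsilon>"
        "{g \<in> holo_funs \<Omega>. \<forall>z\<in>K. dist (g z) (f z) < \<epsilon>} \<subseteq> U"
      unfolding openin_holo_topology by blast
    then have "\<forall>\<^sub>F n in sequentially. \<forall>z\<in>K. dist (F n z) (f z) < \<epsilon>"
      using R by (auto simp: uniform_limit_iff)
    then show "\<forall>\<^sub>F n in sequentially. F n \<in> U"
      by (rule eventually_mono) (use K(4) assms in auto)
  qed
qed

definition taylor_at_0 :: "complex set \<Rightarrow> nat \<Rightarrow> (complex \<Rightarrow> complex) \<Rightarrow> complex \<Rightarrow> complex" where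
  "taylor_at_0 \<Omega> N f = (\<lambda>z\<in>\<Omega>. \<Sum>n\<le>N. (deriv ^^ n) f z / fact n * (- z) ^ n)"

lemma taylor_at_0_in_holo_funs:
  assumes "open \<Omega>" "f \<in> holo_funs \<Omega>"
  shows "taylor_at_0 \<Omega> N f \<in> holo_funs \<Omega>"
proof -
  have "(\<lambda>z. \<Sum>n\<le>N. (deriv ^^ n) f z / fact n * (- z) ^ n) holomorphic_on \<Omega>"
    using assms by (auto intro!: holomorphic_intros simp: holo_funs_def)
  then have "taylor_at_0 \<Omega> N f holomorphic_on \<Omega>"
    by (rule holomorphic_transform) (simp add: taylor_at_0_def)
  then show ?thesis
    by (simp add: holo_funs_def taylor_at_0_def)
qed

definition universal_funs :: "complex set \<Rightarrow> (complex \<Rightarrow> complex) set" where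
  "universal_funs \<Omega> = {f \<in> holo_funs \<Omega>.
     holo_topology \<Omega> closure_of (range (\<lambda>N. taylor_at_0 \<Omega> N f)) = holo_funs \<Omega>}"

end

theory Submission
  imports Defs
begin

text \<open>
  For \<open>0 \<notin> \<Omega>\<close> the operator \<open>T\<^sub>N\<close> multiplies \<open>z\<^sup>-\<^sup>k\<^sup>-\<^sup>1\<close> by the binomial coefficient
  \<open>k + N + 1\<close> over \<open>N\<close>, which tends to infinity with \<open>N\<close>, whereas it maps a polynomial \<open>p\<close> of degree at
  most \<open>N\<close> to the constant \<open>p 0\<close>. Inversion maps a disc whose closure misses \<open>0\<close> to a disc, so functions of the form
  \<open>q (1/z) / z\<close> with a polynomial \<open>q\<close> are dense. Hence a pair \<open>(f, g)\<close> is
  approximated by \<open>(h, T\<^sub>N h)\<close> with \<open>h = p + u\<^sub>N\<close>, where \<open>p\<close> is a polynomial close to \<open>f\<close> and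
  \<open>u\<^sub>N\<close> is the small preimage under \<open>T\<^sub>N\<close> of a function \<open>q (1/z) / z\<close> close to \<open>g - p 0\<close>.
  The claim then follows from the Baire category theorem.
\<close>

section \<open>Baire category\<close>

text \<open>Nested closed neighbourhoods replace the balls of a complete metric. Their radii bound
  the distances between the centres on an exhaustion by compact sets, so the centres converge
  locally uniformly, and the limit is holomorphic. Intersecting with
  \<open>holo_funs \<Omega>\<close> covers the empty family, whose intersection is the set of all
  functions.\<close>

lemma Baire_holo_topology:
  assumes "open \<Omega>" "countable \<G>"
    and op: "\<And>G. G \<in> \<G> \<Longrightarrow> openin (holo_topology \<Omega>) G"
    and dense: "\<And>G. G \<in> \<G> \<Longrightarrow> holo_topology \<Omega> closure_of G = holo_funs \<Omega>"
  shows "holo_topology \<Omega> closure_of (holo_funs \<Omega> \<inter> \<Inter>\<G>) = holo_funs \<Omega>"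
proof (cases "\<G> = {}")
  case True
  then show ?thesis
    using closure_of_topspace[of "holo_topology \<Omega>"] by simp
next
  case False
  define G where "G = from_nat_into \<G>"
  have G: "G n \<in> \<G>" for n
    unfolding G_def by (rule from_nat_into[OF False])
  have Inter_G: "\<Inter>\<G> = (\<Inter>n. G n)"
    unfolding G_def using False assms(2) by simp
  obtain C :: "nat \<Rightarrow> complex set" where C: "\<And>n. compact (C n)" "\<And>n. C n \<subseteq> \<Omega>"
      "\<And>K. \<lbrakk>compact K; K \<subseteq> \<Omega>\<rbrakk> \<Longrightarrow> \<exists>N. \<forall>n\<ge>N. K \<subseteq> C n"
    using open_Union_compact_subsets[OF \<open>open \<Omega>\<close>] by metis
  \<comment> \<open>A triple \<open>(f, K, e)\<close> codes a closed neighbourhood of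
    \<open>f\<close>; its non-strict inequality survives pointwise limits.\<close>
  define W where "W = (\<lambda>(f, K, e). {g \<in> holo_funs \<Omega>. \<forall>z\<in>K. dist (g z) (f z) \<le> e})"
    for f :: "complex \<Rightarrow> complex" and K :: "complex set" and e :: real
  define P where "P = (\<lambda>n (f, K, e). f \<in> holo_funs \<Omega> \<and> compact K \<and> C n \<subseteq> K \<and> K \<subseteq> \<Omega> \<and>
      0 < e \<and> e \<le> (1/2)^n \<and> W (f, K, e) \<subseteq> G n)"
  have refine: "\<exists>x. P n x \<and> W x \<subseteq> V" if V: "openin (holo_topology \<Omega>) V" "V \<noteq> {}" for V n
  proof -
    have "openin (holo_topology \<Omega>) (G n \<inter> V)"
      using op[OF G] V by blast
    moreover have "G n \<inter> V \<noteq> {}"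
      using dense[OF G, of n] V dense_intersects_open[of "holo_topology \<Omega>" "G n"] by auto
    ultimately obtain f K e where f: "f \<in> holo_funs \<Omega>" "compact K" "K \<subseteq> \<Omega>" "0 < e"
        "{g \<in> holo_funs \<Omega>. \<forall>z\<in>K. dist (g z) (f z) < e} \<subseteq> G n \<inter> V"
      unfolding openin_holo_topology by blast
    \<comment> \<open>The bound \<open>e/2\<close> fits a closed neighbourhood into the open one,
      and \<open>(1/2)^n\<close> drives the radii to 0. Enlarging \<open>K\<close> by
      \<open>C n\<close> ensures that each compact set is eventually covered.\<close>
    define e' where "e' = min (e/2) ((1/2)^n)"
    have e': "0 < e'" "e' < e" "e' \<le> (1/2)^n"
      using \<open>0 < e\<close> by (auto simp: e'_def min_less_iff_disj)
    have "W (f, K \<union> C n, e') \<subseteq> G n \<inter> V"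
      using f(5) e'(2) unfolding W_def by force
    then show ?thesis
      using f e' C by (intro exI[of _ "(f, K \<union> C n, e')"]) (auto simp: P_def)
  qed
  have "(holo_funs \<Omega> \<inter> \<Inter>\<G>) \<inter> U \<noteq> {}" if U: "openin (holo_topology \<Omega>) U" "U \<noteq> {}" for U
  proof -
    \<comment> \<open>Containment in \<open>U\<close> is demanded at stage 0 only; the nesting
      passes it on to all later stages.\<close>
    have "\<exists>x. \<forall>n. (P n (x n) \<and> (n = 0 \<longrightarrow> W (x n) \<subseteq> U)) \<and> W (x (Suc n)) \<subseteq> W (x n)"
    proof (rule dependent_nat_choice)
      show "\<exists>x. P 0 x \<and> (0 = (0::nat) \<longrightarrow> W x \<subseteq> U)"
        using refine[OF U] by auto
      fix x n assume x: "P n x \<and> (n = 0 \<longrightarrow> W x \<subseteq> U)"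
      obtain f K e where xe: "x = (f, K, e)" by (cases x)
      \<comment> \<open>\<open>refine\<close> works inside open sets, so the next neighbourhood is
        sought in the open counterpart of \<open>W x\<close>.\<close>
      let ?V = "{g \<in> holo_funs \<Omega>. \<forall>z\<in>K. dist (g z) (f z) < e}"
      have "openin (holo_topology \<Omega>) ?V"
        using x by (intro openin_holo_nbd) (auto simp: P_def xe)
      moreover have "?V \<noteq> {}"
        using x by (auto simp: P_def xe intro!: exI[of _ f])
      moreover have "?V \<subseteq> W x"
        by (auto simp: W_def xe)
      ultimately show "\<exists>y. (P (Suc n) y \<and> (Suc n = 0 \<longrightarrow> W y \<subseteq> U)) \<and> W y \<subseteq> W x"
        using refine[of ?V "Suc n"] by blast
    qed
    then obtain x where x: "\<And>n. P n (x n)" "W (x 0) \<subseteq> U" "\<And>n. W (x (Suc n)) \<subseteq> W (x n)"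
      by blast
    define f where "f n = fst (x n)" for n
    define K where "K n = fst (snd (x n))" for n
    define e where "e n = snd (snd (x n))" for n
    have xfke: "x n = (f n, K n, e n)" for n
      by (simp add: f_def K_def e_def)
    have fn: "f n \<in> holo_funs \<Omega>" "C n \<subseteq> K n" "K n \<subseteq> \<Omega>" "0 < e n" "e n \<le> (1/2)^n"
        "W (x n) \<subseteq> G n" for n
      using x(1)[of n] unfolding xfke P_def by auto
    have fW: "f n \<in> W (x n)" for n
      using fn(1,4)[of n] by (auto simp: W_def xfke)
    have Wdec: "W (x m) \<subseteq> W (x n)" if "n \<le> m" for n m
      using lift_Suc_antimono_le[of "\<lambda>n. W (x n)"] x(3) that by blast
    \<comment> \<open>The centre \<open>f m\<close> lies in its own neighbourhood and hence, by
      nesting, in the \<open>n\<close>-th one.\<close>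
    have near: "dist (f m z) (f n z) \<le> e n" if "n \<le> m" "z \<in> K n" for m n z
      using fW[of m] Wdec[OF that(1)] that(2) by (auto simp: W_def xfke)
    define l where "l z = lim (\<lambda>n. f n z)" for z
    have ul: "uniform_limit L f l sequentially" if L: "compact L" "L \<subseteq> \<Omega>" for L
    proof -
      obtain N where N: "\<And>n. n \<ge> N \<Longrightarrow> L \<subseteq> C n"
        using C(3)[OF L] by blast
      have "uniformly_Cauchy_on L f"
      proof (rule uniformly_Cauchy_onI')
        fix \<epsilon> :: real assume "\<epsilon> > 0"
        then obtain M where M: "(1/2::real)^M < \<epsilon>"
          using real_arch_pow_inv[of \<epsilon> "1/2"] by auto
        have "dist (f m z) (f n z) < \<epsilon>" if "z \<in> L" "m \<ge> max M N" "n > m" for m n z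
        proof -
          have "dist (f n z) (f m z) \<le> e m"
            using that N[of m] fn(2)[of m] by (intro near) auto
          also have "\<dots> \<le> (1/2)^m" by (rule fn)
          also have "\<dots> \<le> (1/2)^M" using that by (intro power_decreasing) auto
          finally show ?thesis using M by (simp add: dist_commute)
        qed
        then show "\<exists>M. \<forall>z\<in>L. \<forall>m\<ge>M. \<forall>n>m. dist (f m z) (f n z) < \<epsilon>" by blast
      qed
      then show ?thesis
        unfolding l_def
        by (simp add: uniformly_convergent_eq_Cauchy flip: uniformly_convergent_uniform_limit_iff)
    qed
    have "l holomorphic_on \<Omega>"
    proof (rule holomorphic_uniform_sequence[OF \<open>open \<Omega>\<close>])
      show "f n holomorphic_on \<Omega>" for n
        using fn(1) by (auto simp: holo_funs_def)
      show "\<exists>d>0. cball z d \<subseteq> \<Omega> \<and> uniform_limit (cball z d) f l sequentially" if "z \<in> \<Omega>" for z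
        using \<open>open \<Omega>\<close> that ul[OF compact_cball] by (meson open_contains_cball)
    qed
    \<comment> \<open>Off \<open>\<Omega>\<close> the value of \<open>l\<close> is whatever
      \<open>lim\<close> returns; restricting makes the limit extensional.\<close>
    then have "restrict l \<Omega> holomorphic_on \<Omega>"
      by (rule holomorphic_transform) auto
    then have lh: "restrict l \<Omega> \<in> holo_funs \<Omega>"
      by (simp add: holo_funs_def)
    have "restrict l \<Omega> \<in> W (x n)" for n
    proof -
      have "dist (l z) (f n z) \<le> e n" if z: "z \<in> K n" for z
      proof -
        have "(\<lambda>m. f m z) \<longlonglongrightarrow> l z"
          using ul[of "{z}"] z fn(3)[of n] by (auto intro: tendsto_uniform_limitI)
        then have "(\<lambda>m. dist (f m z) (f n z)) \<longlonglongrightarrow> dist (l z) (f n z)"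
          by (intro tendsto_intros)
        then show ?thesis
          by (rule LIMSEQ_le_const2) (use near[OF _ z] in blast)
      qed
      then show ?thesis
        using lh fn(3)[of n] by (auto simp: W_def xfke subset_iff)
    qed
    then have "restrict l \<Omega> \<in> (holo_funs \<Omega> \<inter> \<Inter>\<G>) \<inter> U"
      using lh x(2) fn(6) unfolding Inter_G by blast
    then show ?thesis by blast
  qed
  then show ?thesis
    using dense_intersects_open[of "holo_topology \<Omega>" "holo_funs \<Omega> \<inter> \<Inter>\<G>"] by simp
qed

section \<open>The operators \<open>T\<^sub>N\<close>\<close>

text \<open>Cauchy's inequality on discs of radius \<open>\<eta>\<close> about the points of
  \<open>K\<close> bounds the derivatives of \<open>g - f\<close> by its size on the closed
  \<open>\<eta>\<close>-neighbourhood of \<open>K\<close>. This controls the finitely many terms of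
  T_N on \<open>K\<close>.\<close>

lemma continuous_map_taylor_at_0:
  assumes "open \<Omega>"
  shows "continuous_map (holo_topology \<Omega>) (holo_topology \<Omega>) (taylor_at_0 \<Omega> N)"
proof -
  have est: "\<exists>L \<delta>. compact L \<and> L \<subseteq> \<Omega> \<and> 0 < \<delta> \<and>
      (\<forall>g\<in>holo_funs \<Omega>. (\<forall>z\<in>L. dist (g z) (f z) < \<delta>) \<longrightarrow>
        (\<forall>z\<in>K. dist (taylor_at_0 \<Omega> N g z) (taylor_at_0 \<Omega> N f z) < \<epsilon>))"
    if f: "f \<in> holo_funs \<Omega>" and K: "compact K" "K \<subseteq> \<Omega>" and "0 < \<epsilon>" for f K \<epsilon>
  proof -
    obtain \<eta> where \<eta>: "\<eta> > 0" "(\<Union>z\<in>K. cball z \<eta>) \<subseteq> \<Omega>"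
      using compact_subset_open_imp_cball_epsilon_subset[OF K(1) assms K(2)] by blast
    obtain R where R: "\<And>z. z \<in> K \<Longrightarrow> norm z \<le> R" "R > 0"
      using compact_imp_bounded[OF K(1)] unfolding bounded_pos by blast
    \<comment> \<open>Cauchy's inequality and \<open>norm z \<le> R\<close> bound the
      \<open>n\<close>-th term of the difference by \<open>\<delta> * (R / \<eta>)^n\<close>, so the
      total is at most \<open>\<delta> * A\<close>. The factor 2 in \<open>\<delta>\<close> makes
      this strictly less than \<open>\<epsilon>\<close>.\<close>
    define A where "A = (\<Sum>n\<le>N. (R / \<eta>)^n)"
    have A: "A > 0" unfolding A_def using R(2) \<eta>(1) by (intro sum_pos) auto
    define \<delta> where "\<delta> = \<epsilon> / (2 * A)"
    have \<delta>: "\<delta> > 0" using A \<open>0 < \<epsilon>\<close> by (simp add: \<delta>_def)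
    have "dist (taylor_at_0 \<Omega> N g z) (taylor_at_0 \<Omega> N f z) < \<epsilon>"
      if g: "g \<in> holo_funs \<Omega>" "\<forall>z\<in>(\<Union>z\<in>K. cball z \<eta>). dist (g z) (f z) < \<delta>" and z: "z \<in> K" for g z
    proof -
      have hol: "f holomorphic_on \<Omega>" "g holomorphic_on \<Omega>"
        using f g by (auto simp: holo_funs_def)
      have zo: "z \<in> \<Omega>" using K z by blast
      have cb: "cball z \<eta> \<subseteq> \<Omega>" using \<eta> z by blast
      define h where "h w = g w - f w" for w
      have h: "h holomorphic_on cball z \<eta>"
        unfolding h_def using hol cb by (intro holomorphic_intros) (auto intro: holomorphic_on_subset)
      have C: "norm ((deriv ^^ n) h z) \<le> fact n * \<delta> / \<eta> ^ n" for n
      proof (rule Cauchy_inequality)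
        show "h holomorphic_on ball z \<eta>" using h by (rule holomorphic_on_subset) auto
        show "continuous_on (cball z \<eta>) h" using h by (rule holomorphic_on_imp_continuous_on)
        show "norm (h w) \<le> \<delta>" if "norm (z - w) = \<eta>" for w
          using g(2) z that by (auto simp: h_def dist_norm intro!: less_imp_le)
      qed fact
      have "taylor_at_0 \<Omega> N g z - taylor_at_0 \<Omega> N f z = (\<Sum>n\<le>N. (deriv ^^ n) h z / fact n * (- z) ^ n)"
        unfolding taylor_at_0_def h_def using zo
        by (simp add: higher_deriv_diff[OF hol(2,1) assms zo] sum_subtractf[symmetric] diff_divide_distrib left_diff_distrib)
      also have "norm \<dots> \<le> (\<Sum>n\<le>N. \<delta> * (R / \<eta>)^n)"
      proof (rule sum_norm_le)
        fix n
        have "norm ((deriv ^^ n) h z / fact n * (- z) ^ n) = norm ((deriv ^^ n) h z) / fact n * norm z ^ n"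
          by (simp add: norm_mult norm_divide norm_power)
        also have "\<dots> \<le> (fact n * \<delta> / \<eta> ^ n) / fact n * R ^ n"
          using C R z \<delta> \<eta> by (intro mult_mono divide_right_mono power_mono) auto
        finally show "norm ((deriv ^^ n) h z / fact n * (- z) ^ n) \<le> \<delta> * (R / \<eta>)^n"
          by (simp add: power_divide)
      qed
      also have "\<dots> = \<delta> * A" by (simp add: A_def sum_distrib_left)
      also have "\<dots> < \<epsilon>" using A \<open>0 < \<epsilon>\<close> by (simp add: \<delta>_def)
      finally show ?thesis by (simp add: dist_norm)
    qed
    then show ?thesis
      using compact_minkowski_sum_cball[OF K(1), of \<eta>] \<eta>(2) \<delta>
      by (intro exI[of _ "\<Union>z\<in>K. cball z \<eta>"] exI[of _ \<delta>]) auto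
  qed
  show ?thesis
    unfolding continuous_map_def topspace_holo_topology
  proof (intro conjI allI impI)
    show "taylor_at_0 \<Omega> N \<in> holo_funs \<Omega> \<rightarrow> holo_funs \<Omega>"
      using taylor_at_0_in_holo_funs[OF assms] by auto
    fix U assume U: "openin (holo_topology \<Omega>) U"
    show "openin (holo_topology \<Omega>) {f \<in> holo_funs \<Omega>. taylor_at_0 \<Omega> N f \<in> U}"
      unfolding openin_holo_topology
    proof (intro conjI ballI)
      fix f assume f: "f \<in> {f \<in> holo_funs \<Omega>. taylor_at_0 \<Omega> N f \<in> U}"
      then obtain K \<epsilon> where K: "compact K" "K \<subseteq> \<Omega>" "0 < \<epsilon>"
          "{g \<in> holo_funs \<Omega>. \<forall>z\<in>K. dist (g z) (taylor_at_0 \<Omega> N f z) < \<epsilon>} \<subseteq> U"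
        using U unfolding openin_holo_topology by blast
      obtain L \<delta> where L: "compact L" "L \<subseteq> \<Omega>" "0 < \<delta>"
          "\<And>g. \<lbrakk>g \<in> holo_funs \<Omega>; \<forall>z\<in>L. dist (g z) (f z) < \<delta>\<rbrakk> \<Longrightarrow>
            \<forall>z\<in>K. dist (taylor_at_0 \<Omega> N g z) (taylor_at_0 \<Omega> N f z) < \<epsilon>"
        using est[OF _ K(1-3), of f] f by blast
      have "{g \<in> holo_funs \<Omega>. \<forall>z\<in>L. dist (g z) (f z) < \<delta>} \<subseteq> {f \<in> holo_funs \<Omega>. taylor_at_0 \<Omega> N f \<in> U}"
        using L(4) K(4) taylor_at_0_in_holo_funs[OF assms] by blast
      with L(1-3) show "\<exists>L \<delta>. compact L \<and> L \<subseteq> \<Omega> \<and> 0 < \<delta> \<and>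
          {g \<in> holo_funs \<Omega>. \<forall>z\<in>L. dist (g z) (f z) < \<delta>} \<subseteq> {f \<in> holo_funs \<Omega>. taylor_at_0 \<Omega> N f \<in> U}"
        by blast
    qed auto
  qed
qed

lemma higher_deriv_sum:
  assumes "finite A" "open S" "z \<in> S" "\<And>k. k \<in> A \<Longrightarrow> f k holomorphic_on S"
  shows "(deriv ^^ n) (\<lambda>w. \<Sum>k\<in>A. f k w) z = (\<Sum>k\<in>A. (deriv ^^ n) (f k) z)"
  using assms(1,4)
proof (induction A rule: finite_induct)
  case (insert k A)
  have "(deriv ^^ n) (\<lambda>w. f k w + (\<Sum>k\<in>A. f k w)) z
      = (deriv ^^ n) (f k) z + (deriv ^^ n) (\<lambda>w. \<Sum>k\<in>A. f k w) z"
    using insert by (intro higher_deriv_add[OF _ _ assms(2,3)] holomorphic_intros) auto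
  then show ?case using insert by simp
qed auto

text \<open>The rising product (k+1)...(k+n) is written as \<open>fact n\<close> times a binomial
  coefficient, so that division by \<open>fact n\<close> in the Taylor sum leaves the binomial
  alone.\<close>

lemma higher_deriv_inverse_power:
  fixes z :: complex
  assumes "z \<noteq> 0"
  shows "(deriv ^^ n) (\<lambda>w. inverse w ^ Suc k) z =
    (-1) ^ n * fact n * of_nat (k + n choose n) * inverse z ^ (Suc k + n)"
  using assms
proof (induction n arbitrary: z)
  case (Suc n)
  define c :: complex where "c = (-1) ^ n * fact n * of_nat (k + n choose n)"
  \<comment> \<open>The induction hypothesis holds at nonzero points only, and \<open>deriv\<close>
    needs the equality on a neighbourhood of \<open>z\<close>.\<close>
  have ev: "\<forall>\<^sub>F w in nhds z. w \<noteq> 0"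
    using Suc.prems by (intro t1_space_nhds)
  have "(deriv ^^ Suc n) (\<lambda>w. inverse w ^ Suc k) z = deriv (\<lambda>w. c * inverse w ^ (Suc k + n)) z"
    unfolding funpow.simps comp_def
    by (rule deriv_cong_ev[OF eventually_mono[OF ev]]) (use Suc.IH in \<open>auto simp: c_def\<close>)
  also have "\<dots> = - c * of_nat (Suc k + n) * inverse z ^ (Suc k + Suc n)"
  proof -
    have "((\<lambda>w. c * inverse w ^ Suc (k + n)) has_field_derivative
        c * ((1 + of_nat (k + n)) * (- (inverse z ^ Suc (Suc 0)) * inverse z ^ (k + n)))) (at z)"
      using Suc.prems by (intro DERIV_cmult DERIV_power_Suc DERIV_inverse)
    then show ?thesis
      by (intro DERIV_imp_deriv) (simp add: mult_ac)
  qed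
  finally have deriv: "(deriv ^^ Suc n) (\<lambda>w. inverse w ^ Suc k) z
      = - c * of_nat (Suc k + n) * inverse z ^ (Suc k + Suc n)" .
  have "c * of_nat (Suc k + n) = (-1) ^ n * fact n * of_nat (Suc (k + n) * (k + n choose n))"
    by (simp add: c_def algebra_simps)
  \<comment> \<open>The absorption identity for binomial coefficients turns the factor k+n+1 into
    n+1, which completes \<open>fact (Suc n)\<close>.\<close>
  also have "\<dots> = (-1) ^ n * fact n * of_nat (Suc n * (Suc (k + n) choose Suc n))"
    by (simp only: Suc_times_binomial)
  finally have "c * of_nat (Suc k + n) = (-1) ^ n * fact n * of_nat (Suc n * (Suc (k + n) choose Suc n))" .
  then have "- c * of_nat (Suc k + n) = (-1) ^ Suc n * fact (Suc n) * of_nat (k + Suc n choose Suc n)"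
    by (simp add: algebra_simps del: binomial_Suc_Suc)
  with deriv show ?case by (simp only:)
qed simp

text \<open>The Taylor series of a polynomial about \<open>z\<close> stops at its degree and
  converges to the polynomial everywhere, in particular at 0.\<close>

lemma taylor_poly_at_0:
  fixes p :: "complex poly"
  assumes "degree p \<le> N"
  shows "(\<Sum>n\<le>N. (deriv ^^ n) (poly p) z / fact n * (- z) ^ n) = poly p 0"
proof -
  have d: "(deriv ^^ n) (poly p) = poly ((pderiv ^^ n) p)" for n
  proof (induction n)
    case (Suc n)
    then show ?case by (auto intro!: DERIV_imp_deriv poly_DERIV)
  qed simp
  \<comment> \<open>The radius \<open>norm z + 1\<close> puts the point 0 inside the disc about
    \<open>z\<close>.\<close>
  have "(\<lambda>n. (deriv ^^ n) (poly p) z / fact n * (0 - z) ^ n) sums poly p 0"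
    by (rule holomorphic_power_series[where r = "norm z + 1"]) (auto intro!: holomorphic_intros)
  moreover have "(pderiv ^^ n) p = 0" if "n > N" for n
    using that assms by (intro poly_eqI) (simp add: coeff_higher_pderiv coeff_eq_0)
  then have "(\<lambda>n. (deriv ^^ n) (poly p) z / fact n * (0 - z) ^ n)
      sums (\<Sum>n\<le>N. (deriv ^^ n) (poly p) z / fact n * (0 - z) ^ n)"
    by (intro sums_finite) (auto simp: d)
  ultimately show ?thesis
    using sums_unique2 by fastforce
qed

text \<open>All signs and powers of \<open>z\<close> cancel in the Taylor terms of
  \<open>inverse z ^ Suc k\<close>, leaving the hockey-stick sum of the binomials
  \<open>k + n choose n\<close> over \<open>n \<le> N\<close>. Hence these powers are eigenfunctions
  of T_N.\<close>

lemma taylor_at_0_poly_plus_inverse_powers: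
  fixes p :: "complex poly"
  assumes "open \<Omega>" "0 \<notin> \<Omega>" "z \<in> \<Omega>" "degree p \<le> N"
  shows "taylor_at_0 \<Omega> N (\<lambda>z\<in>\<Omega>. poly p z + (\<Sum>k\<le>d. b k * inverse z ^ Suc k)) z =
    poly p 0 + (\<Sum>k\<le>d. b k * of_nat (Suc (k + N) choose N) * inverse z ^ Suc k)"
proof -
  have z: "z \<noteq> 0" using assms by auto
  have hol: "(\<lambda>w. inverse w ^ Suc k) holomorphic_on \<Omega>" for k
    using assms by (auto intro!: holomorphic_intros)
  have inv: "(\<Sum>n\<le>N. (deriv ^^ n) (\<lambda>w. inverse w ^ Suc k) z / fact n * (- z) ^ n)
      = of_nat (Suc (k + N) choose N) * inverse z ^ Suc k" for k
  proof -
    have "(deriv ^^ n) (\<lambda>w. inverse w ^ Suc k) z / fact n * (- z) ^ n =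
        of_nat (k + n choose n) * inverse z ^ Suc k" for n
    proof -
      have "(-1) ^ n * (- z) ^ n * inverse z ^ n = 1"
        using z by (simp flip: power_mult_distrib)
      moreover have "(deriv ^^ n) (\<lambda>w. inverse w ^ Suc k) z / fact n * (- z) ^ n =
          of_nat (k + n choose n) * inverse z ^ Suc k * ((-1) ^ n * (- z) ^ n * inverse z ^ n)"
        unfolding higher_deriv_inverse_power[OF z] power_add by (simp add: mult_ac)
      ultimately show ?thesis by simp
    qed
    then show ?thesis
      by (simp add: sum_choose_lower flip: sum_distrib_right of_nat_sum del: power_Suc)
  qed
  define F where "F = (\<lambda>z\<in>\<Omega>. poly p z + (\<Sum>k\<le>d. b k * inverse z ^ Suc k))"
  have "(deriv ^^ n) F z =
      (deriv ^^ n) (poly p) z + (\<Sum>k\<le>d. b k * (deriv ^^ n) (\<lambda>w. inverse w ^ Suc k) z)" for n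
  proof -
    \<comment> \<open>\<open>F\<close> is \<open>undefined\<close> off \<open>\<Omega>\<close>, but
      it agrees with the formula near \<open>z\<close> because \<open>\<Omega>\<close> is
      open.\<close>
    have "(deriv ^^ n) F z =
        (deriv ^^ n) (\<lambda>z. poly p z + (\<Sum>k\<le>d. b k * inverse z ^ Suc k)) z"
      by (rule higher_deriv_cong_ev[OF eventually_mono[OF eventually_nhds_in_open[OF assms(1,3)]]])
        (simp_all add: F_def)
    also have "\<dots> = (deriv ^^ n) (poly p) z + (deriv ^^ n) (\<lambda>z. \<Sum>k\<le>d. b k * inverse z ^ Suc k) z"
      by (rule higher_deriv_add[OF _ _ assms(1,3)]) (use assms(2) in \<open>auto intro!: holomorphic_intros\<close>)
    also have "(deriv ^^ n) (\<lambda>z. \<Sum>k\<le>d. b k * inverse z ^ Suc k) z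
        = (\<Sum>k\<le>d. (deriv ^^ n) (\<lambda>z. b k * inverse z ^ Suc k) z)"
      by (rule higher_deriv_sum[OF _ assms(1,3)]) (use assms(2) in \<open>auto intro!: holomorphic_intros\<close>)
    also have "\<dots> = (\<Sum>k\<le>d. b k * (deriv ^^ n) (\<lambda>w. inverse w ^ Suc k) z)"
      using higher_deriv_cmult[OF hol assms(3,1)] by simp
    finally show ?thesis .
  qed
  then have "taylor_at_0 \<Omega> N F z =
      (\<Sum>n\<le>N. (deriv ^^ n) (poly p) z / fact n * (- z) ^ n) +
      (\<Sum>n\<le>N. \<Sum>k\<le>d. b k * ((deriv ^^ n) (\<lambda>w. inverse w ^ Suc k) z / fact n * (- z) ^ n))"
    using assms(3) unfolding taylor_at_0_def
    by (simp add: add_divide_distrib sum_divide_distrib distrib_right sum_distrib_right sum.distrib mult.assoc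
        del: power_Suc)
  also have "(\<Sum>n\<le>N. \<Sum>k\<le>d. b k * ((deriv ^^ n) (\<lambda>w. inverse w ^ Suc k) z / fact n * (- z) ^ n))
      = (\<Sum>k\<le>d. b k * (of_nat (Suc (k + N) choose N) * inverse z ^ Suc k))"
    by (subst sum.swap) (simp only: inv flip: sum_distrib_left)
  finally show ?thesis
    unfolding F_def taylor_poly_at_0[OF assms(4)] mult.assoc .
qed

section \<open>Approximation on discs\<close>

lemma compact_subset_ball_smaller:
  fixes c :: "'a :: metric_space"
  assumes "compact K" "K \<subseteq> ball c r" "0 < r"
  obtains s where "0 < s" "s < r" "K \<subseteq> ball c s"
proof (cases "K = {}")
  case True
  then show ?thesis using that[of "r/2"] assms by auto
next
  case False
  have "continuous_on K (dist c)" by (intro continuous_intros)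
  then obtain w where w: "w \<in> K" "\<And>z. z \<in> K \<Longrightarrow> dist c z \<le> dist c w"
    using continuous_attains_sup[OF assms(1) False] by blast
  have "dist c w < r" using w assms by auto
  then show ?thesis
    using w(2) assms(3) by (intro that[of "(dist c w + r) / 2"]) (force intro: add_nonneg_pos)+
qed

lemma poly_approx_on_ball:
  assumes f: "f holomorphic_on ball c r" and K: "compact K" "K \<subseteq> ball c r" and "0 < \<epsilon>"
  obtains p where "\<And>z. z \<in> K \<Longrightarrow> norm (poly p z - f z) < \<epsilon>"
proof (cases "0 < r")
  case False
  then have "K = {}" using K by (simp add: ball_empty)
  then show ?thesis using that by blast
next
  case True
  then obtain s where s: "0 < s" "s < r" "K \<subseteq> ball c s"
    using compact_subset_ball_smaller[OF K] by blast
  define a where "a n = (deriv ^^ n) f c / fact n" for n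
  have sums: "(\<lambda>n. a n * (w - c) ^ n) sums f w" if "w \<in> ball c r" for w
    using holomorphic_power_series[OF f that] by (simp add: a_def)
  have "ereal s < conv_radius a"
  proof -
    \<comment> \<open>Summability at a point strictly between \<open>s\<close> and \<open>r\<close>
      puts the convergence radius strictly above \<open>s\<close>, which gives uniform convergence
      on the closed disc of radius \<open>s\<close>.\<close>
    define t where "t = (s + r) / 2"
    have t: "s < t" "t < r" using s by (auto simp: t_def)
    have "summable (\<lambda>n. a n * of_real t ^ n)"
      using sums[of "c + of_real t"] t s by (auto simp: dist_norm sums_iff)
    from conv_radius_geI[OF this] show ?thesis
      using t s by (auto intro: less_le_trans[of _ "ereal t"])
  qed
  from powser_uniform_limit[OF this, of c]
  have "uniform_limit (cball c s) (\<lambda>n z. \<Sum>i<n. a i * (z - c) ^ i) f sequentially"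
    by (rule uniform_limit_cong'[THEN iffD1, rotated -1])
       (use sums s in \<open>auto intro!: sums_unique[symmetric]\<close>)
  then have "\<forall>\<^sub>F n in sequentially. \<forall>z\<in>cball c s. dist (\<Sum>i<n. a i * (z - c) ^ i) (f z) < \<epsilon>"
    using \<open>0 < \<epsilon>\<close> by (rule uniform_limitD)
  then obtain n where n: "\<And>z. z \<in> cball c s \<Longrightarrow> dist (\<Sum>i<n. a i * (z - c) ^ i) (f z) < \<epsilon>"
    using eventually_happens'[OF sequentially_bot] by blast
  show ?thesis
    by (rule that[of "\<Sum>i<n. Polynomial.smult (a i) ([:-c, 1:] ^ i)"])
       (use n s in \<open>force simp: poly_sum dist_norm\<close>)
qed

text \<open>With d = |a|^2 - s^2 > 0, clearing denominators reduces the claim to the identity |cnj a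
  * z - d|^2 - s^2 |z|^2 = d (|a - z|^2 - s^2).\<close>

lemma inversion_disc_iff:
  fixes z a :: complex
  assumes "z \<noteq> 0" "0 < s" "s < norm a"
  shows "inverse z \<in> ball (cnj a / of_real ((norm a)\<^sup>2 - s\<^sup>2)) (s / ((norm a)\<^sup>2 - s\<^sup>2)) \<longleftrightarrow> z \<in> ball a s"
proof -
  define d where "d = (norm a)\<^sup>2 - s\<^sup>2"
  have d: "d > 0" using assms by (simp add: d_def power_strict_mono)
  have sq_less_iff: "x\<^sup>2 < y\<^sup>2 \<longleftrightarrow> x < y" if "0 \<le> x" "0 \<le> y" for x y :: real
    using that power_mono_iff[of y x 2] by (simp flip: not_le)
  have "norm (cnj a / of_real d - inverse z) = norm (cnj a * z - of_real d) / (d * norm z)"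
  proof -
    have "cnj a / of_real d - inverse z = (cnj a * z - of_real d) / (of_real d * z)"
      using d assms(1) by (simp add: field_simps)
    then show ?thesis using d by (simp add: norm_divide norm_mult)
  qed
  then have "inverse z \<in> ball (cnj a / of_real d) (s / d) \<longleftrightarrow>
      norm (cnj a * z - of_real d) / (d * norm z) < s / d"
    by (simp add: dist_norm)
  also have "\<dots> \<longleftrightarrow> norm (cnj a * z - of_real d) < s * norm z"
    using d assms(1) by (simp add: divide_simps mult_ac)
  also have "\<dots> \<longleftrightarrow> (norm (cnj a * z - of_real d))\<^sup>2 < (s * norm z)\<^sup>2"
    using sq_less_iff[of "norm (cnj a * z - of_real d)" "s * norm z"] assms by simp
  also have "(norm (cnj a * z - of_real d))\<^sup>2 - (s * norm z)\<^sup>2 = d * ((norm (a - z))\<^sup>2 - s\<^sup>2)"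
    unfolding power_mult_distrib d_def cmod_power2 by (simp add: power2_eq_square algebra_simps)
  then have "(norm (cnj a * z - of_real d))\<^sup>2 < (s * norm z)\<^sup>2 \<longleftrightarrow> d * ((norm (a - z))\<^sup>2 - s\<^sup>2) < 0"
    by linarith
  also have "\<dots> \<longleftrightarrow> (norm (a - z))\<^sup>2 < s\<^sup>2"
    using d by (simp add: mult_less_0_iff)
  also have "\<dots> \<longleftrightarrow> z \<in> ball a s"
    using sq_less_iff[of "norm (a - z)" s] assms by (simp add: dist_norm)
  finally show ?thesis by (simp add: d_def)
qed

text \<open>A polynomial approximating f(1/w)/w on the inverted disc is evaluated at w = 1/z and
  multiplied by 1/z. The extra factor 1/z leaves only strictly negative powers of \<open>z\<close>,
  those that T_N enlarges. Passing to radius \<open>s < r\<close> matters because 0 may lie on the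
  boundary of \<open>ball a r\<close>.\<close>

lemma inverse_poly_approx_on_ball:
  assumes f: "f holomorphic_on ball a r" and K: "compact K" "K \<subseteq> ball a r" and "0 < \<epsilon>"
    and "0 < r" "0 \<notin> ball a r"
  obtains p where "\<And>z. z \<in> K \<Longrightarrow> norm (inverse z * poly p (inverse z) - f z) < \<epsilon>"
proof -
  obtain s where s: "0 < s" "s < r" "K \<subseteq> ball a s"
    using compact_subset_ball_smaller[OF K \<open>0 < r\<close>] by blast
  have sa: "s < norm a" using s assms(6) by (simp add: dist_norm)
  define d where "d = (norm a)\<^sup>2 - s\<^sup>2"
  have d: "d > 0" using s sa by (simp add: d_def power_strict_mono)
  define B where "B = ball (cnj a / of_real d) (s / d)"
  have iff: "inverse z \<in> B \<longleftrightarrow> z \<in> ball a s" if "z \<noteq> 0" for z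
    using inversion_disc_iff[OF that s(1) sa] by (simp add: B_def d_def)
  have B0: "0 \<notin> B"
    using d sa by (simp add: B_def dist_norm norm_divide divide_less_cancel)
  have nz: "z \<noteq> 0" if "z \<in> K" for z using that K assms(6) by auto
  have hol: "(\<lambda>w. inverse w * f (inverse w)) holomorphic_on B"
  proof -
    have "inverse ` B \<subseteq> ball a s"
      using iff B0 by (metis image_subsetI inverse_inverse_eq inverse_zero)
    then have "inverse ` B \<subseteq> ball a r" using s by force
    then have "(f \<circ> inverse) holomorphic_on B"
      using B0 f by (intro holomorphic_on_compose_gen[of inverse B f "ball a r"] holomorphic_intros) auto
    then show ?thesis
      using B0 by (auto intro!: holomorphic_intros simp: comp_def)
  qed
  have comp: "compact (inverse ` K)"
    using K nz by (intro compact_continuous_image continuous_intros) auto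
  have sub: "inverse ` K \<subseteq> B" using iff nz s(3) by blast
  \<comment> \<open>The factor \<open>norm a - s\<close> compensates for the final multiplication by
    1/z, since \<open>norm z > norm a - s\<close> on \<open>K\<close>.\<close>
  have "0 < \<epsilon> * (norm a - s)" using \<open>0 < \<epsilon>\<close> sa by simp
  then obtain p where p: "\<And>w. w \<in> inverse ` K \<Longrightarrow>
      norm (poly p w - inverse w * f (inverse w)) < \<epsilon> * (norm a - s)"
    using poly_approx_on_ball[OF hol[unfolded B_def] comp sub[unfolded B_def]] by blast
  show ?thesis
  proof
    fix z assume z: "z \<in> K"
    have "dist a z < s" using z s by auto
    then have "norm a - s < norm z"
      using norm_triangle_ineq2[of a z] by (simp add: dist_norm)
    have "inverse z * poly p (inverse z) - f z = inverse z * (poly p (inverse z) - inverse (inverse z) * f (inverse (inverse z)))"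
      using nz[OF z] by (simp add: algebra_simps)
    then have "norm (inverse z * poly p (inverse z) - f z) =
        norm (poly p (inverse z) - inverse (inverse z) * f (inverse (inverse z))) / norm z"
      by (simp only: norm_mult norm_inverse) (simp add: field_simps)
    also have "\<dots> < \<epsilon> * (norm a - s) / norm z"
      using p[of "inverse z"] z nz[OF z] by (intro divide_strict_right_mono) auto
    also have "\<dots> \<le> \<epsilon>"
      using \<open>norm a - s < norm z\<close> nz[OF z] \<open>0 < \<epsilon>\<close> by (simp add: divide_le_eq)
    finally show "norm (inverse z * poly p (inverse z) - f z) < \<epsilon>" .
  qed
qed

text \<open>Induction along Horner's scheme a + z p(z): half of the error goes to the constant
  coefficient, and the tail gets \<open>\<epsilon> / (2 * R)\<close> because it is multiplied by
  \<open>z\<close>.\<close>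

lemma poly_approx_coeffs_dense:
  fixes p :: "complex poly"
  assumes dense: "\<And>U. \<lbrakk>open U; U \<noteq> {}\<rbrakk> \<Longrightarrow> \<exists>q\<in>Q. q \<in> U" and "0 < R" "0 < \<epsilon>"
  shows "\<exists>cs\<in>lists Q. \<forall>z. norm z \<le> R \<longrightarrow> norm (poly (Poly cs) z - poly p z) < \<epsilon>"
  using \<open>0 < \<epsilon>\<close>
proof (induction p arbitrary: \<epsilon>)
  case 0
  then show ?case by (intro bexI[of _ "[]"]) auto
next
  case (pCons a p)
  obtain q where q: "q \<in> Q" "dist a q < \<epsilon> / 2"
    using dense[of "ball a (\<epsilon> / 2)"] pCons.prems by auto
  have "0 < \<epsilon> / (2 * R)" using pCons.prems assms by simp
  then obtain cs where cs: "cs \<in> lists Q"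
      "\<And>z. norm z \<le> R \<Longrightarrow> norm (poly (Poly cs) z - poly p z) < \<epsilon> / (2 * R)"
    using pCons.IH by blast
  have "norm (poly (Poly (q # cs)) z - poly (pCons a p) z) < \<epsilon>" if z: "norm z \<le> R" for z
  proof -
    have "poly (Poly (q # cs)) z - poly (pCons a p) z = (q - a) + z * (poly (Poly cs) z - poly p z)"
      by (simp add: algebra_simps)
    also have "norm \<dots> \<le> norm (q - a) + norm z * norm (poly (Poly cs) z - poly p z)"
      by (metis norm_mult norm_triangle_ineq)
    also have "norm z * norm (poly (Poly cs) z - poly p z) \<le> R * (\<epsilon> / (2 * R))"
      using cs(2)[OF z] z assms by (intro mult_mono) auto
    also have "R * (\<epsilon> / (2 * R)) = \<epsilon> / 2" using assms by simp
    finally show ?thesis using q(2) by (simp add: dist_norm norm_minus_commute)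
  qed
  then show ?case using q cs by (intro bexI[of _ "q # cs"]) auto
qed

text \<open>Polynomials with coefficients in a countable dense set suffice. Separability reduces
  universality to countably many targets, as the Baire argument requires.\<close>

lemma holo_topology_ball_separable:
  obtains D where "countable D" "D \<subseteq> holo_funs (ball a r)"
    "holo_topology (ball a r) closure_of D = holo_funs (ball a r)"
proof -
  obtain Q :: "complex set" where Q: "countable Q" "\<And>U. \<lbrakk>open U; U \<noteq> {}\<rbrakk> \<Longrightarrow> \<exists>q\<in>Q. q \<in> U"
    by (metis countable_dense_exists)
  define D where "D = (\<lambda>cs. restrict (poly (Poly cs)) (ball a r)) ` lists Q"
  have D: "D \<subseteq> holo_funs (ball a r)"
    by (auto simp: D_def holo_funs_def intro!: holomorphic_intros holomorphic_transform[of "poly _"])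
  have "D \<inter> U \<noteq> {}" if U: "openin (holo_topology (ball a r)) U" "U \<noteq> {}" for U
  proof -
    obtain f K \<epsilon> where f: "f \<in> holo_funs (ball a r)" "compact K" "K \<subseteq> ball a r" "0 < \<epsilon>"
        "{g \<in> holo_funs (ball a r). \<forall>z\<in>K. dist (g z) (f z) < \<epsilon>} \<subseteq> U"
      using U unfolding openin_holo_topology by blast
    have "f holomorphic_on ball a r" "0 < \<epsilon> / 2" using f by (auto simp: holo_funs_def)
    then obtain p where p: "\<And>z. z \<in> K \<Longrightarrow> norm (poly p z - f z) < \<epsilon> / 2"
      using poly_approx_on_ball f(2,3) by blast
    obtain R where R: "R > 0" "\<And>z. z \<in> K \<Longrightarrow> norm z \<le> R"
      using compact_imp_bounded[OF f(2)] unfolding bounded_pos by blast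
    obtain cs where cs: "cs \<in> lists Q" "\<And>z. norm z \<le> R \<Longrightarrow> norm (poly (Poly cs) z - poly p z) < \<epsilon> / 2"
      using poly_approx_coeffs_dense[OF Q(2) R(1) \<open>0 < \<epsilon> / 2\<close>] by blast
    have "dist (poly (Poly cs) z) (f z) < \<epsilon>" if "z \<in> K" for z
      using p[OF that] cs(2)[OF R(2)[OF that]] dist_triangle[of "poly (Poly cs) z" "f z" "poly p z"]
      by (simp add: dist_norm)
    moreover have g: "restrict (poly (Poly cs)) (ball a r) \<in> D" using cs by (auto simp: D_def)
    ultimately have "restrict (poly (Poly cs)) (ball a r) \<in> U"
      using f(3,5) D by (auto simp: subset_iff)
    then show ?thesis using g by blast
  qed
  then show ?thesis
    using that[of D] D Q(1) dense_intersects_open[of "holo_topology (ball a r)" D] by (simp add: D_def)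
qed

section \<open>Universality\<close>

text \<open>This is topological transitivity of the sequence T_N, and it supplies the density of the
  open sets in the Baire argument.\<close>

lemma taylor_at_0_transitive:
  assumes r: "0 < r" "0 \<notin> ball a r" and f: "f \<in> holo_funs (ball a r)" and g: "g \<in> holo_funs (ball a r)"
    and K: "compact K" "K \<subseteq> ball a r" and "0 < \<epsilon>"
  obtains h N where "h \<in> holo_funs (ball a r)" "\<And>z. z \<in> K \<Longrightarrow> dist (h z) (f z) < \<epsilon>"
    "\<And>z. z \<in> K \<Longrightarrow> dist (taylor_at_0 (ball a r) N h z) (g z) < \<epsilon>"
proof -
  have hol: "f holomorphic_on ball a r" "g holomorphic_on ball a r"
    using f g by (auto simp: holo_funs_def)
  obtain p where p: "\<And>z. z \<in> K \<Longrightarrow> norm (poly p z - f z) < \<epsilon> / 2"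
    using poly_approx_on_ball[OF hol(1) K, of "\<epsilon> / 2"] \<open>0 < \<epsilon>\<close> by auto
  \<comment> \<open>T_N will contribute the constant \<open>poly p 0\<close> from \<open>p\<close>,
    so it is subtracted from the target beforehand.\<close>
  have "(\<lambda>z. g z - poly p 0) holomorphic_on ball a r"
    using hol by (intro holomorphic_intros)
  then obtain q where q: "\<And>z. z \<in> K \<Longrightarrow> norm (inverse z * poly q (inverse z) - (g z - poly p 0)) < \<epsilon>"
    using inverse_poly_approx_on_ball[OF _ K \<open>0 < \<epsilon>\<close> r] by blast
  have nz: "z \<noteq> 0" if "z \<in> K" for z using that K r by auto
  define A where "A z = (\<Sum>k\<le>degree q. norm (coeff q k) * norm (inverse z) ^ Suc k)" for z :: complex
  have "continuous_on K A"
    unfolding A_def using nz by (intro continuous_intros) auto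
  then have "bounded (A ` K)"
    using K by (intro compact_imp_bounded compact_continuous_image)
  then obtain M where M: "M > 0" "\<And>z. z \<in> K \<Longrightarrow> norm (A z) \<le> M"
    unfolding bounded_pos by auto
  obtain N0 :: nat where N0: "2 * M / \<epsilon> < real N0"
    using reals_Archimedean2 by blast
  \<comment> \<open>\<open>N \<ge> degree p\<close> makes T_N send \<open>p\<close> to
    \<open>poly p 0\<close>; \<open>N \<ge> N0\<close> makes the correction to \<open>p\<close>
    smaller than \<open>\<epsilon> / 2\<close>. Dividing by the eigenvalues in \<open>b\<close> lets
    T_N restore the coefficients of \<open>q\<close> exactly.\<close>
  define N where "N = max N0 (degree p)"
  define b where "b k = coeff q k / of_nat (Suc (k + N) choose N)" for k
  define h where "h = (\<lambda>z\<in>ball a r. poly p z + (\<Sum>k\<le>degree q. b k * inverse z ^ Suc k))"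
  \<comment> \<open>The case k = 0 gives N + 1 and the binomial grows with \<open>k\<close>, so one
    lower bound serves all coefficients.\<close>
  have binom: "real N \<le> real (Suc (k + N) choose N)" for k
  proof -
    have "Suc N choose N \<le> Suc (k + N) choose N" by (rule binomial_right_mono) simp
    then show ?thesis by (simp add: binomial_symmetric[of N "Suc N"])
  qed
  have "2 * M / \<epsilon> < real N" using N0 by (simp add: N_def)
  moreover have "0 < 2 * M / \<epsilon>" using M \<open>0 < \<epsilon>\<close> by simp
  ultimately have "0 < real N" by linarith
  with \<open>2 * M / \<epsilon> < real N\<close> \<open>0 < \<epsilon>\<close> have N: "0 < real N" "M / real N < \<epsilon> / 2"
    by (auto simp: field_simps)
  have b_mult: "b k * of_nat (Suc (k + N) choose N) = coeff q k" for k
    using binom[of k] N(1) by (simp add: b_def del: binomial_Suc_Suc of_nat_Suc)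
  show ?thesis
  proof (rule that[of h N])
    have "(\<lambda>z. poly p z + (\<Sum>k\<le>degree q. b k * inverse z ^ Suc k)) holomorphic_on ball a r"
      using r by (auto intro!: holomorphic_intros)
    then have "h holomorphic_on ball a r"
      by (rule holomorphic_transform) (simp add: h_def)
    then show "h \<in> holo_funs (ball a r)"
      by (simp add: holo_funs_def h_def)
    fix z assume z: "z \<in> K"
    then have zb: "z \<in> ball a r" using K by blast
    have "norm (\<Sum>k\<le>degree q. b k * inverse z ^ Suc k)
        \<le> (\<Sum>k\<le>degree q. norm (coeff q k) * norm (inverse z) ^ Suc k / real N)"
    proof (rule sum_norm_le)
      fix k
      have "norm (b k * inverse z ^ Suc k)
          = norm (coeff q k) * norm (inverse z) ^ Suc k / real (Suc (k + N) choose N)"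
        by (simp add: b_def norm_mult norm_divide norm_power del: binomial_Suc_Suc of_nat_Suc)
      also have "\<dots> \<le> norm (coeff q k) * norm (inverse z) ^ Suc k / real N"
        using binom[of k] N(1) by (intro divide_left_mono mult_pos_pos) auto
      finally show "norm (b k * inverse z ^ Suc k)
          \<le> norm (coeff q k) * norm (inverse z) ^ Suc k / real N" .
    qed
    also have "\<dots> = A z / real N" by (simp add: A_def sum_divide_distrib)
    also have "\<dots> \<le> M / real N" using M(2)[OF z] N(1) by (intro divide_right_mono) auto
    also have "\<dots> < \<epsilon> / 2" by (rule N)
    finally have "norm ((poly p z - f z) + (\<Sum>k\<le>degree q. b k * inverse z ^ Suc k)) < \<epsilon>"
      using p[OF z] norm_triangle_ineq[of "poly p z - f z"] by (smt (verit) field_sum_of_halves)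
    then show "dist (h z) (f z) < \<epsilon>"
      using zb by (simp add: h_def dist_norm algebra_simps)
    have "taylor_at_0 (ball a r) N h z
        = poly p 0 + (\<Sum>k\<le>degree q. b k * of_nat (Suc (k + N) choose N) * inverse z ^ Suc k)"
      unfolding h_def by (rule taylor_at_0_poly_plus_inverse_powers) (use r zb in \<open>auto simp: N_def\<close>)
    also have "(\<Sum>k\<le>degree q. b k * of_nat (Suc (k + N) choose N) * inverse z ^ Suc k)
        = inverse z * poly q (inverse z)"
      unfolding b_mult by (simp add: poly_altdef sum_distrib_left mult_ac)
    finally show "dist (taylor_at_0 (ball a r) N h z) (g z) < \<epsilon>"
      using q[OF z] by (simp add: dist_norm algebra_simps)
  qed
qed

text \<open>The index \<open>m\<close> governs both the compact set and the tolerance; as both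
  improve with \<open>m\<close>, a single countable parameter reaches every basic
  neighbourhood.\<close>

lemma universal_funs_eq_Inter:
  fixes C :: "nat \<Rightarrow> complex set"
  assumes "open \<Omega>" "D \<subseteq> holo_funs \<Omega>" "holo_topology \<Omega> closure_of D = holo_funs \<Omega>"
    and C: "\<And>n. compact (C n)" "\<And>n. C n \<subseteq> \<Omega>"
      "\<And>K. \<lbrakk>compact K; K \<subseteq> \<Omega>\<rbrakk> \<Longrightarrow> \<exists>N. \<forall>n\<ge>N. K \<subseteq> C n"
  shows "universal_funs \<Omega> = holo_funs \<Omega> \<inter> (\<Inter>(q, m) \<in> D \<times> UNIV.
    {f \<in> holo_funs \<Omega>. \<exists>N. \<forall>z\<in>C m. dist (taylor_at_0 \<Omega> N f z) (q z) < 1 / Suc m})"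
proof -
  note dense_iff = dense_intersects_open[of "holo_topology \<Omega>", unfolded topspace_holo_topology]
  have iff: "(holo_topology \<Omega> closure_of (range (\<lambda>N. taylor_at_0 \<Omega> N f)) = holo_funs \<Omega>) \<longleftrightarrow>
    (\<forall>q\<in>D. \<forall>m. \<exists>N. \<forall>z\<in>C m. dist (taylor_at_0 \<Omega> N f z) (q z) < 1 / Suc m)" (is "?L \<longleftrightarrow> ?R")
    if f: "f \<in> holo_funs \<Omega>" for f
  proof
    assume L: ?L
    show ?R
    proof (intro ballI allI)
      fix q m assume "q \<in> D"
      let ?V = "{g \<in> holo_funs \<Omega>. \<forall>z\<in>C m. dist (g z) (q z) < 1 / Suc m}"
      have "openin (holo_topology \<Omega>) ?V"
        using \<open>q \<in> D\<close> assms(2) C by (intro openin_holo_nbd) auto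
      moreover have "q \<in> ?V"
        using \<open>q \<in> D\<close> assms(2) by auto
      ultimately have "range (\<lambda>N. taylor_at_0 \<Omega> N f) \<inter> ?V \<noteq> {}"
        using L unfolding dense_iff by blast
      then show "\<exists>N. \<forall>z\<in>C m. dist (taylor_at_0 \<Omega> N f z) (q z) < 1 / Suc m"
        by blast
    qed
  next
    assume R: ?R
    show ?L
      unfolding dense_iff
    proof (intro allI impI)
      fix U assume U: "openin (holo_topology \<Omega>) U \<and> U \<noteq> {}"
      then obtain u K \<epsilon> where u: "u \<in> holo_funs \<Omega>" "compact K" "K \<subseteq> \<Omega>" "0 < \<epsilon>"
          "{g \<in> holo_funs \<Omega>. \<forall>z\<in>K. dist (g z) (u z) < \<epsilon>} \<subseteq> U"
        unfolding openin_holo_topology by blast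
      obtain m1 where m1: "\<And>n. n \<ge> m1 \<Longrightarrow> K \<subseteq> C n"
        using C(3)[OF u(2,3)] by blast
      obtain m2 :: nat where m2: "2 / \<epsilon> < real m2"
        using reals_Archimedean2 by blast
      \<comment> \<open>Large enough that \<open>K \<subseteq> C m\<close> and that two errors of
        \<open>1 / Suc m\<close>, from \<open>u\<close> to \<open>q\<close> and from
        \<open>q\<close> to T_N f, add up to less than \<open>\<epsilon>\<close>.\<close>
      define m where "m = max m1 m2"
      have "2 / \<epsilon> < real (Suc m)" using m2 by (simp add: m_def)
      then have m: "2 / real (Suc m) < \<epsilon>"
        using \<open>0 < \<epsilon>\<close> by (simp add: field_simps del: of_nat_Suc)
      let ?V = "{g \<in> holo_funs \<Omega>. \<forall>z\<in>C m. dist (g z) (u z) < 1 / Suc m}"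
      have "openin (holo_topology \<Omega>) ?V"
        using u C by (intro openin_holo_nbd) auto
      moreover have "u \<in> ?V" using u by auto
      ultimately have "D \<inter> ?V \<noteq> {}"
        using assms(3) unfolding dense_iff by blast
      then obtain q where q: "q \<in> D" "\<And>z. z \<in> C m \<Longrightarrow> dist (q z) (u z) < 1 / Suc m"
        by blast
      obtain N where N: "\<And>z. z \<in> C m \<Longrightarrow> dist (taylor_at_0 \<Omega> N f z) (q z) < 1 / Suc m"
        using R q(1) by blast
      have "dist (taylor_at_0 \<Omega> N f z) (u z) < \<epsilon>" if "z \<in> K" for z
      proof -
        have "z \<in> C m" using m1[of m] that by (auto simp: m_def)
        then have "dist (taylor_at_0 \<Omega> N f z) (u z) < 1 / Suc m + 1 / Suc m"
          using N q(2) dist_triangle[of "taylor_at_0 \<Omega> N f z" "u z" "q z"] by (smt (verit))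
        then show ?thesis using m by simp
      qed
      then have "taylor_at_0 \<Omega> N f \<in> U"
        using u(5) taylor_at_0_in_holo_funs[OF assms(1) f] by blast
      then show "range (\<lambda>N. taylor_at_0 \<Omega> N f) \<inter> U \<noteq> {}" by blast
    qed
  qed
  have "universal_funs \<Omega> = {f \<in> holo_funs \<Omega>. \<forall>q\<in>D. \<forall>m. \<exists>N. \<forall>z\<in>C m. dist (taylor_at_0 \<Omega> N f z) (q z) < 1 / Suc m}"
    unfolding universal_funs_def by (intro Collect_cong conj_cong refl iff)
  then show ?thesis by (auto simp del: of_nat_Suc)
qed

theorem theorem2p6:
  fixes z0 :: complex and r :: real
  assumes "r > 0" and "0 \<notin> ball z0 r"
  shows "gdelta_in (holo_topology (ball z0 r)) (universal_funs (ball z0 r)) \<and>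
    holo_topology (ball z0 r) closure_of universal_funs (ball z0 r) = holo_funs (ball z0 r)"
proof -
  define \<Omega> where "\<Omega> = ball z0 r"
  have "open \<Omega>" by (simp add: \<Omega>_def)
  obtain C :: "nat \<Rightarrow> complex set" where C: "\<And>n. compact (C n)" "\<And>n. C n \<subseteq> \<Omega>"
      "\<And>K. \<lbrakk>compact K; K \<subseteq> \<Omega>\<rbrakk> \<Longrightarrow> \<exists>N. \<forall>n\<ge>N. K \<subseteq> C n"
    using open_Union_compact_subsets[OF \<open>open \<Omega>\<close>] by metis
  obtain D where D: "countable D" "D \<subseteq> holo_funs \<Omega>" "holo_topology \<Omega> closure_of D = holo_funs \<Omega>"
    using holo_topology_ball_separable unfolding \<Omega>_def by blast
  define G where "G = (\<lambda>(q :: complex \<Rightarrow> complex, m).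
    {f \<in> holo_funs \<Omega>. \<exists>N. \<forall>z\<in>C m. dist (taylor_at_0 \<Omega> N f z) (q z) < 1 / Suc m})"
  have univ: "universal_funs \<Omega> = holo_funs \<Omega> \<inter> \<Inter>(G ` (D \<times> UNIV))"
    using universal_funs_eq_Inter[OF \<open>open \<Omega>\<close> D(2,3) C] by (simp add: G_def)
  have G_open: "openin (holo_topology \<Omega>) (G (q, m))" if "q \<in> D" for q m
  proof -
    let ?V = "{g \<in> holo_funs \<Omega>. \<forall>z\<in>C m. dist (g z) (q z) < 1 / Suc m}"
    have "openin (holo_topology \<Omega>) ?V"
      using that D(2) C by (intro openin_holo_nbd) auto
    \<comment> \<open>\<open>G (q, m)\<close> is the union over \<open>N\<close> of the preimages of
      \<open>?V\<close> under the continuous maps T_N.\<close>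
    then have "openin (holo_topology \<Omega>) {f \<in> holo_funs \<Omega>. taylor_at_0 \<Omega> N f \<in> ?V}" for N
      by (rule openin_continuous_map_preimage[OF continuous_map_taylor_at_0[OF \<open>open \<Omega>\<close>],
            unfolded topspace_holo_topology])
    then have "openin (holo_topology \<Omega>) (\<Union>N. {f \<in> holo_funs \<Omega>. taylor_at_0 \<Omega> N f \<in> ?V})"
      by blast
    also have "(\<Union>N. {f \<in> holo_funs \<Omega>. taylor_at_0 \<Omega> N f \<in> ?V}) = G (q, m)"
      using taylor_at_0_in_holo_funs[OF \<open>open \<Omega>\<close>] by (auto simp: G_def)
    finally show ?thesis .
  qed
  have G_dense: "holo_topology \<Omega> closure_of (G (q, m)) = holo_funs \<Omega>" if "q \<in> D" for q m
  proof -
    have "G (q, m) \<inter> U \<noteq> {}" if U: "openin (holo_topology \<Omega>) U" "U \<noteq> {}" for U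
    proof -
      obtain f K \<epsilon> where f: "f \<in> holo_funs \<Omega>" "compact K" "K \<subseteq> \<Omega>" "0 < \<epsilon>"
          "{g \<in> holo_funs \<Omega>. \<forall>z\<in>K. dist (g z) (f z) < \<epsilon>} \<subseteq> U"
        using U unfolding openin_holo_topology by blast
      \<comment> \<open>Working on \<open>K \<union> C m\<close> with the smaller tolerance lets one
        function \<open>h\<close> witness membership in both \<open>U\<close> and
        \<open>G (q, m)\<close>.\<close>
      have "q \<in> holo_funs \<Omega>" "compact (K \<union> C m)" "K \<union> C m \<subseteq> \<Omega>" "0 < min \<epsilon> (1 / Suc m)"
        using \<open>q \<in> D\<close> D(2) f C by auto
      then obtain h N where h: "h \<in> holo_funs \<Omega>"
          "\<And>z. z \<in> K \<union> C m \<Longrightarrow> dist (h z) (f z) < min \<epsilon> (1 / Suc m)"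
          "\<And>z. z \<in> K \<union> C m \<Longrightarrow> dist (taylor_at_0 \<Omega> N h z) (q z) < min \<epsilon> (1 / Suc m)"
        using taylor_at_0_transitive[OF assms] f(1) unfolding \<Omega>_def by metis
      have "h \<in> U" using h f(5) by auto
      moreover have "h \<in> G (q, m)"
        using h(1,3) unfolding G_def by force
      ultimately show ?thesis by blast
    qed
    then show ?thesis
      using dense_intersects_open[of "holo_topology \<Omega>" "G (q, m)"] by simp
  qed
  have "countable (G ` (D \<times> UNIV))" using D(1) by simp
  then have "holo_topology \<Omega> closure_of universal_funs \<Omega> = holo_funs \<Omega>"
    unfolding univ by (rule Baire_holo_topology[OF \<open>open \<Omega>\<close>]) (use G_open G_dense in auto)
  moreover have "gdelta_in (holo_topology \<Omega>) (universal_funs \<Omega>)"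
  proof -
    \<comment> \<open>Adding the whole space to the family makes it visibly nonempty and its
      intersection exactly the set in \<open>univ\<close>.\<close>
    have "gdelta_in (holo_topology \<Omega>) (\<Inter>(insert (holo_funs \<Omega>) (G ` (D \<times> UNIV))))"
      using D(1) G_open gdelta_in_topspace[of "holo_topology \<Omega>"]
      by (intro gdelta_in_Inter) (auto intro: open_imp_gdelta_in)
    then show ?thesis by (simp add: univ)
  qed
  ultimately show ?thesis by (simp add: \<Omega>_def)
qed

end
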